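(* Let $F$ be any probability distribution on $\mathbb{R}$ with right-unbounded support, and let $g:\mathbb{R}\to(0,\infty)$ be a positive, strictly increasing function satisfying $\lim_{x\to\infty} g(x)=\infty$. Then, for any $n\in\mathbb{N}$ and any integer $k$ with $1<k\leqslant n$, there exist independent real-valued random variables $\xi_1,\ldots,\xi_n$ such that the following properties hold: 1. For any set of indices $1\leqslant i_1<i_2<\dots<i_k\leqslant n$, the distribution $F$ stochastically dominates the distribution of $\min(\xi_{i_1},\dots,\xi_{i_k})$. 2. For any set of indices $1\leqslant i_1<i_2<\dots<i_{k-1}\leqslant n$, we have $$\mathbb{E}\, g\bigl(\min(\xi_{i_1},\dots,\xi_{i_{k-1}})\bigr)=\infty.$$
   Context: The same symbol $F$ denotes a probability distribution on the real line and its distribution function $F(x)$. The distribution $F$ has right-unbounded support if $F(x)<1$ for all $x\in\mathbb{R}$. A distribution $F$ stochastically dominates a distribution $G$ if $F(x)\leqslant G(x)$ for all $x\in\mathbb{R}$. *)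

theory Defs imports "HOL-Probability.Probability" begin

definition right_unbounded_support :: "real measure \<Rightarrow> bool" where
  "right_unbounded_support F \<longleftrightarrow> (\<forall>x. cdf F x < 1)"

definition stochastically_dominates :: "real measure \<Rightarrow> real measure \<Rightarrow> bool" where
  "stochastically_dominates F G \<longleftrightarrow> (\<forall>x. cdf F x \<le> cdf G x)"

end

theory Submission imports Defs begin

text \<open>
  Start from independent \<open>\<eta>\<^sub>1, \<dots>, \<eta>\<^sub>n\<close> with distribution \<open>F\<close>, and round them to a very sparse grid
  \<open>a\<^sub>0 < a\<^sub>1 < \<dots>\<close>.  Every cell \<open>(a\<^sub>j, a\<^sub>j\<^sub>+\<^sub>1]\<close> carries a set \<open>S\<^sub>j\<close> of \<open>k - 1\<close> indices; a value
  \<open>\<eta>\<^sub>i\<close> in this cell is rounded up if \<open>i \<in> S\<^sub>j\<close> and down otherwise, which gives \<open>\<xi>\<^sub>i\<close>; values up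
  to \<open>a\<^sub>0\<close> do not move.  The sets \<open>S\<^sub>j\<close> are chosen so that every set of \<open>k - 1\<close> indices appears infinitely often.

  A set of \<open>k\<close> indices is too large to be contained in \<open>S\<^sub>j\<close>.  Hence, for a level \<open>x\<close> with
  \<open>a\<^sub>j \<le> x < a\<^sub>j\<^sub>+\<^sub>1\<close>, it has an index \<open>i\<close> that rounds down in the \<open>j\<close>-th cell, so that \<open>\<eta>\<^sub>i \<le> x\<close> forces
  \<open>\<xi>\<^sub>i \<le> x\<close>, and the minimum is at most \<open>x\<close> with probability at least \<open>F(x)\<close>
  (\<open>alternating_round_level_preserved\<close>).

  A set \<open>I\<close> of \<open>k - 1\<close> indices equals \<open>S\<^sub>j\<close> for infinitely many \<open>j\<close>.  For these \<open>j\<close>, the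
  minimum over \<open>I\<close> reaches \<open>a\<^sub>j\<^sub>+\<^sub>1\<close> as soon as all the \<open>\<eta>\<^sub>i\<close>, \<open>i \<in> I\<close>, exceed \<open>a\<^sub>j\<close>
  (\<open>alternating_round_ge_next\<close>), an event whose probability \<open>(1 - F(a\<^sub>j))\<^bsup>k-1\<^esup>\<close> is positive and
  depends, for given \<open>F\<close> and \<open>k\<close>, on \<open>a\<^sub>j\<close> only.  So \<open>a\<^sub>j\<^sub>+\<^sub>1\<close> can be taken so large that
  the event contributes at least \<open>j\<close> to the expectation of \<open>g\<close> (\<open>exists_sparse_grid\<close>), which is therefore infinite.
\<close>

section \<open>Rounding to a grid with alternating directions\<close>

text \<open>
  Values up to \<open>a 0\<close> stay where they are: the grid has no point below them, and leaving them
  unchanged preserves all levels below \<open>a 0\<close>.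
\<close>

definition alternating_round :: "(nat \<Rightarrow> real) \<Rightarrow> (nat \<Rightarrow> 'i set) \<Rightarrow> 'i \<Rightarrow> real \<Rightarrow> real" where
  "alternating_round a S i y =
    (if y \<le> a 0 then y
     else let j = (LEAST j. y \<le> a (Suc j)) in if i \<in> S j then a (Suc j) else a j)"

lemma alternating_round_measurable [measurable]:
  "alternating_round a S i \<in> borel_measurable borel"
proof -
  have [measurable]: "(\<lambda>y. LEAST j. y \<le> a (Suc j)) \<in> measurable borel (count_space UNIV)"
    by (rule measurable_Least) simp
  have [measurable]: "(\<lambda>j. if i \<in> S j then a (Suc j) else a j) \<in> measurable (count_space UNIV) borel"
    by simp
  have "(\<lambda>y. (\<lambda>j. if i \<in> S j then a (Suc j) else a j) (LEAST j. y \<le> a (Suc j)))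
      \<in> borel_measurable borel"
    by measurable
  then have "(\<lambda>y. if y \<le> a 0 then y else (\<lambda>j. if i \<in> S j then a (Suc j) else a j)
      (LEAST j. y \<le> a (Suc j))) \<in> borel_measurable borel"
    by measurable
  then show ?thesis
    by (simp add: alternating_round_def[abs_def] Let_def)
qed

lemma grid_cell_closed_right:
  fixes a :: "nat \<Rightarrow> real"
  assumes "strict_mono a" and "filterlim a at_top sequentially" and "a 0 < y"
  obtains j where "(LEAST j. y \<le> a (Suc j)) = j" and "a j < y" and "y \<le> a (Suc j)"
proof -
  define j where "j = (LEAST j. y \<le> a (Suc j))"
  have "eventually (\<lambda>j. y \<le> a j) sequentially"
    using assms(2) by (simp add: filterlim_at_top)
  then obtain N where "\<And>m. m \<ge> N \<Longrightarrow> y \<le> a m"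
    by (auto simp: eventually_sequentially)
  then have "y \<le> a (Suc N)" by simp
  then have up: "y \<le> a (Suc j)" unfolding j_def by (rule LeastI)
  have "a j < y"
  proof (cases j)
    case (Suc m)
    then have "\<not> y \<le> a (Suc m)" using not_less_Least[of m "\<lambda>j. y \<le> a (Suc j)"] j_def by simp
    then show ?thesis using Suc by simp
  qed (use assms(3) in simp)
  then show thesis using up that j_def by blast
qed

lemma grid_cell_closed_left:
  fixes a :: "nat \<Rightarrow> real"
  assumes "filterlim a at_top sequentially" and "a 0 \<le> x"
  obtains j where "a j \<le> x" and "x < a (Suc j)"
proof -
  define j where "j = (LEAST j. x < a (Suc j))"
  have "eventually (\<lambda>j. x < a j) sequentially"
    using assms(1) by (simp add: filterlim_at_top_dense)
  then obtain N where "\<And>m. m \<ge> N \<Longrightarrow> x < a m"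
    by (auto simp: eventually_sequentially)
  then have "x < a (Suc N)" by simp
  then have up: "x < a (Suc j)" unfolding j_def by (rule LeastI)
  have "a j \<le> x"
  proof (cases j)
    case (Suc m)
    then have "\<not> x < a (Suc m)" using not_less_Least[of m "\<lambda>j. x < a (Suc j)"] j_def by simp
    then show ?thesis using Suc by simp
  qed (use assms(2) in simp)
  then show thesis using up that by blast
qed

text \<open>
  Rounding moves a value \<open>y \<le> x\<close> above \<open>x\<close> only if both lie in the same cell and the value is
  rounded up there: a value from an earlier cell stops at a grid point that is at most \<open>x\<close>.
  An index outside the set of the cell of \<open>x\<close> therefore never crosses the level \<open>x\<close>, and \<open>I\<close>
  contains such an index.  Below \<open>a 0\<close> nothing moves, and any index will do.
\<close>

lemma alternating_round_level_preserved:
  assumes a: "strict_mono a" "filterlim a at_top sequentially"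
    and not_all_up: "\<And>j. \<not> I \<subseteq> S j"
  obtains i where "i \<in> I" and "\<And>y. y \<le> x \<Longrightarrow> alternating_round a S i y \<le> x"
proof (cases "a 0 \<le> x")
  case True
  then obtain j where j: "a j \<le> x" "x < a (Suc j)"
    using grid_cell_closed_left[OF a(2)] by blast
  obtain i where i: "i \<in> I" "i \<notin> S j" using not_all_up[of j] by blast
  have "alternating_round a S i y \<le> x" if "y \<le> x" for y
  proof (cases "y \<le> a 0")
    case False
    then obtain m where m: "(LEAST j. y \<le> a (Suc j)) = m" "a m < y" "y \<le> a (Suc m)"
      using grid_cell_closed_right[OF a, of y] by auto
    have "a m < a (Suc j)" using m \<open>y \<le> x\<close> j by simp
    then have "m \<le> j" using a(1) by (simp add: strict_mono_less)
    show ?thesis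
    proof (cases "m = j")
      case True
      then show ?thesis using False m i j by (simp add: alternating_round_def)
    next
      case False
      then have "a (Suc m) \<le> a j" using \<open>m \<le> j\<close> a(1) by (simp add: strict_mono_less_eq)
      then show ?thesis using m j \<open>y \<le> x\<close> \<open>\<not> y \<le> a 0\<close> by (simp add: alternating_round_def)
    qed
  qed (use that in \<open>simp add: alternating_round_def\<close>)
  then show thesis using that i(1) by blast
next
  case False
  obtain i where "i \<in> I" using not_all_up[of 0] by blast
  moreover have "alternating_round a S i y \<le> x" if "y \<le> x" for y
    using False that by (simp add: alternating_round_def)
  ultimately show thesis using that by blast
qed

text \<open>
  The value \<open>y\<close> itself may lie in a later cell and be rounded down there, but then it stops at a
  grid point not below \<open>a (Suc j)\<close>.
\<close>

lemma alternating_round_ge_next: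
  assumes a: "strict_mono a" "filterlim a at_top sequentially"
    and "i \<in> S j" and "a j < y"
  shows "a (Suc j) \<le> alternating_round a S i y"
proof -
  have "a 0 \<le> a j" using a(1) by (simp add: strict_mono_less_eq)
  then have "a 0 < y" using assms(4) by simp
  then obtain m where m: "(LEAST j. y \<le> a (Suc j)) = m" "a m < y" "y \<le> a (Suc m)"
    using grid_cell_closed_right[OF a] by blast
  have "a j < a (Suc m)" using m assms(4) by simp
  then have "j \<le> m" using a(1) by (simp add: strict_mono_less)
  show ?thesis
  proof (cases "m = j")
    case True
    then show ?thesis using m \<open>a 0 < y\<close> assms(3) by (simp add: alternating_round_def)
  next
    case False
    then have "a (Suc j) \<le> a m" using \<open>j \<le> m\<close> a(1) by (simp add: strict_mono_less_eq)
    moreover have "a m \<le> a (Suc m)" using a(1) by (simp add: strict_mono_less_eq)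
    ultimately show ?thesis using m \<open>a 0 < y\<close> by (simp add: alternating_round_def)
  qed
qed

section \<open>Choice of the grid and of the index sets\<close>

text \<open>
  Each new grid point is chosen after the weight \<open>w\<close> of the previous one is known; divergence of
  \<open>g\<close> then makes up for any positive weight, however small.
\<close>

lemma exists_sparse_grid:
  fixes g w :: "real \<Rightarrow> real"
  assumes "filterlim g at_top at_top" and w: "\<And>x. 0 < w x"
  obtains a :: "nat \<Rightarrow> real" where "strict_mono a" and "filterlim a at_top sequentially"
    and "\<And>j. real j \<le> g (a (Suc j)) * w (a j)"
proof -
  have "\<exists>y. x + 1 \<le> y \<and> real j \<le> g y * w x" for x j
  proof -
    have "eventually (\<lambda>y. real j / w x \<le> g y) at_top"
      using assms(1) by (simp add: filterlim_at_top)
    then have "eventually (\<lambda>y. x + 1 \<le> y \<and> real j / w x \<le> g y) at_top"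
      by (intro eventually_conj eventually_ge_at_top)
    then obtain y where "x + 1 \<le> y" "real j / w x \<le> g y"
      using eventually_happens[of _ "at_top :: real filter"] by auto
    then show ?thesis using w[of x] by (auto simp: divide_le_eq)
  qed
  then obtain nxt where nxt: "\<And>x j. x + 1 \<le> nxt x j" "\<And>x j. real j \<le> g (nxt x j) * w x"
    by metis
  define a where "a = rec_nat (0 :: real) (\<lambda>j x. nxt x j)"
  have a_Suc: "a (Suc j) = nxt (a j) j" for j by (simp add: a_def)
  have step: "a j + 1 \<le> a (Suc j)" for j using nxt(1) a_Suc by simp
  have "strict_mono a"
    unfolding strict_mono_Suc_iff using step by (smt (verit))
  moreover have "real j \<le> a j" for j
  proof (induction j)
    case 0
    show ?case by (simp add: a_def)
  next
    case (Suc j)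
    then show ?case using step[of j] by simp
  qed
  then have "filterlim a at_top sequentially"
    by (intro filterlim_at_top_mono[OF filterlim_real_sequentially]) simp
  moreover have "real j \<le> g (a (Suc j)) * w (a j)" for j
    using nxt(2) a_Suc by simp
  ultimately show thesis using that by blast
qed

text \<open>
  Reading \<open>j\<close> as the code of a pair \<open>(m, b)\<close> and ignoring \<open>b\<close> repeats each entry \<open>m\<close> of an
  ordinary enumeration infinitely often.
\<close>

lemma exists_recurrent_enumeration:
  assumes "countable A" and "A \<noteq> {}"
  obtains s :: "nat \<Rightarrow> 'a" where "\<And>j. s j \<in> A" and "\<And>x N. x \<in> A \<Longrightarrow> \<exists>j\<ge>N. s j = x"
proof
  let ?s = "\<lambda>j. from_nat_into A (fst (prod_decode j))"
  show "?s j \<in> A" for j using assms(2) by (rule from_nat_into)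
  fix x N assume "x \<in> A"
  then obtain m where "from_nat_into A m = x"
    using from_nat_into_surj[OF assms(1)] by blast
  then have "?s (prod_encode (m, N)) = x" by simp
  then show "\<exists>j\<ge>N. ?s j = x" using le_prod_encode_2 by blast
qed

section \<open>The rounded product sample\<close>

text \<open>
  Independence means that the joint distribution is the product of the marginals.  The joint map
  is the restriction to \<open>I\<close>, which is the identity on the product space.
\<close>

lemma (in product_prob_space) indep_vars_coordinates:
  assumes "I \<noteq> {}"
  shows "prob_space.indep_vars (Pi\<^sub>M I M) M (\<lambda>i \<omega>. \<omega> i) I"
proof (subst indep_vars_iff_distr_eq_PiM'[OF assms])
  show "random_variable (M i) (\<lambda>\<omega>. \<omega> i)" if "i \<in> I" for i
    using that by measurable
  have "distr (Pi\<^sub>M I M) (Pi\<^sub>M I M) (\<lambda>\<omega>. \<lambda>i\<in>I. \<omega> i) = distr (Pi\<^sub>M I M) (Pi\<^sub>M I M) (\<lambda>\<omega>. \<omega>)"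
    by (rule distr_cong) (auto simp: space_PiM)
  also have "\<dots> = Pi\<^sub>M I M" by simp
  also have "\<dots> = (\<Pi>\<^sub>M i\<in>I. distr (Pi\<^sub>M I M) (M i) (\<lambda>\<omega>. \<omega> i))"
    by (rule PiM_cong) (simp_all add: PiM_component)
  finally show "distr (Pi\<^sub>M I M) (Pi\<^sub>M I M) (\<lambda>\<omega>. \<lambda>i\<in>I. \<omega> i)
      = (\<Pi>\<^sub>M i\<in>I. distr (Pi\<^sub>M I M) (M i) (\<lambda>\<omega>. \<omega> i))" .
qed

theorem theorem1p5:
  fixes F :: "real measure" and g :: "real \<Rightarrow> real" and n k :: nat
  assumes "real_distribution F"
    and "right_unbounded_support F"
    and "\<forall>x. 0 < g x"
    and "strict_mono g"
    and "filterlim g at_top at_top"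
    and "1 < k" and "k \<le> n"
  shows "\<exists>(M :: (nat \<Rightarrow> real) measure) (\<xi> :: nat \<Rightarrow> (nat \<Rightarrow> real) \<Rightarrow> real).
    prob_space M \<and>
    prob_space.indep_vars M (\<lambda>_. borel) \<xi> {1..n} \<and>
    (\<forall>I. I \<subseteq> {1..n} \<and> card I = k \<longrightarrow>
      stochastically_dominates F (distr M borel (\<lambda>\<omega>. Min ((\<lambda>i. \<xi> i \<omega>) ` I)))) \<and>
    (\<forall>I. I \<subseteq> {1..n} \<and> card I = k - 1 \<longrightarrow>
      (\<integral>\<^sup>+ \<omega>. ennreal (g (Min ((\<lambda>i. \<xi> i \<omega>) ` I))) \<partial>M) = \<infinity>)"
proof -
  interpret F: real_distribution F by fact
  have [measurable_cong]: "sets F = sets borel" by simp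
  have tail: "F.prob {x<..} = 1 - cdf F x" for x
  proof -
    have "{x<..} = space F - {..x}" by auto
    then show ?thesis using F.prob_compl[of "{..x}"] by (simp add: cdf_def)
  qed
  have tail_pos: "0 < F.prob {x<..}" for x
    using assms(2) by (simp add: tail right_unbounded_support_def)

  define \<S> where "\<S> = {S. S \<subseteq> {1..n} \<and> card S = k - 1}"
  have "finite \<S>" by (simp add: \<S>_def)
  then have "countable \<S>" by (rule countable_finite)
  moreover have "{1..k - 1} \<in> \<S>" using assms(7) by (auto simp: \<S>_def)
  then have "\<S> \<noteq> {}" by blast
  ultimately obtain S :: "nat \<Rightarrow> nat set"
    where S: "\<And>j. S j \<in> \<S>" "\<And>I N. I \<in> \<S> \<Longrightarrow> \<exists>j\<ge>N. S j = I"
    by (rule exists_recurrent_enumeration) blast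
  have finite_S: "finite (S j)" for j
    using S(1)[of j] by (auto simp: \<S>_def intro: finite_subset)

  obtain a where a: "strict_mono a" "filterlim a at_top sequentially"
    and a_sparse: "\<And>j. real j \<le> g (a (Suc j)) * F.prob {a j<..} ^ (k - 1)"
    using exists_sparse_grid[OF assms(5), of "\<lambda>x. F.prob {x<..} ^ (k - 1)"] tail_pos by auto

  define M where "M = Pi\<^sub>M {1..n} (\<lambda>_. F)"
  interpret P: product_prob_space "\<lambda>_. F" "{1..n}" by standard
  have prob_M: "prob_space M" unfolding M_def by (rule P.prob_space_axioms)
  interpret M: prob_space M by fact
  define \<xi> where "\<xi> i \<omega> = alternating_round a S i (\<omega> i)" for i and \<omega> :: "nat \<Rightarrow> real"
  have \<xi>_meas: "\<xi> i \<in> borel_measurable M" if "i \<in> {1..n}" for i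
    unfolding \<xi>_def[abs_def] M_def using that by measurable

  have "M.indep_vars (\<lambda>_. F) (\<lambda>i \<omega>. \<omega> i) {1..n}"
    unfolding M_def by (rule P.indep_vars_coordinates) (use assms in auto)
  then have indep: "M.indep_vars (\<lambda>_. borel) \<xi> {1..n}"
    unfolding \<xi>_def[abs_def]
    by (rule M.indep_vars_compose2[where Y = "\<lambda>i. alternating_round a S i"]) measurable

  have dom: "stochastically_dominates F (distr M borel (\<lambda>\<omega>. Min ((\<lambda>i. \<xi> i \<omega>) ` I)))"
    if I: "I \<subseteq> {1..n}" "card I = k" for I
    unfolding stochastically_dominates_def
  proof
    fix x
    have finI: "finite I" using I(1) finite_subset by blast
    have meas: "(\<lambda>\<omega>. Min ((\<lambda>i. \<xi> i \<omega>) ` I)) \<in> borel_measurable M"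
      by (rule borel_measurable_Min[OF finI]) (use \<xi>_meas I in auto)
    have "\<not> I \<subseteq> S j" for j
    proof
      assume "I \<subseteq> S j"
      then have "card I \<le> card (S j)" using finite_S by (rule card_mono[rotated])
      then show False using I(2) S(1)[of j] assms(6) by (auto simp: \<S>_def)
    qed
    then obtain i where i: "i \<in> I" and below: "\<And>y. y \<le> x \<Longrightarrow> alternating_round a S i y \<le> x"
      using alternating_round_level_preserved[OF a] by blast
    have "cdf F x = measure (distr M F (\<lambda>\<omega>. \<omega> i)) {..x}"
      using P.PiM_component[of i] i I(1) by (simp add: cdf_def M_def subset_iff)
    also have "\<dots> = M.prob ((\<lambda>\<omega>. \<omega> i) -` {..x} \<inter> space M)"
      by (rule measure_distr) (use i I(1) in \<open>auto simp: M_def\<close>)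
    also have "\<dots> \<le> M.prob ((\<lambda>\<omega>. Min ((\<lambda>i. \<xi> i \<omega>) ` I)) -` {..x} \<inter> space M)"
    proof (rule M.finite_measure_mono)
      show "(\<lambda>\<omega>. Min ((\<lambda>i. \<xi> i \<omega>) ` I)) -` {..x} \<inter> space M \<in> M.events"
        using meas by (rule measurable_sets) simp
      have "Min ((\<lambda>i. \<xi> i \<omega>) ` I) \<le> x" if "\<omega> i \<le> x" for \<omega>
      proof -
        have "Min ((\<lambda>i. \<xi> i \<omega>) ` I) \<le> \<xi> i \<omega>" using finI i by simp
        also have "\<dots> \<le> x" using below that by (simp add: \<xi>_def)
        finally show ?thesis .
      qed
      then show "(\<lambda>\<omega>. \<omega> i) -` {..x} \<inter> space M
          \<subseteq> (\<lambda>\<omega>. Min ((\<lambda>i. \<xi> i \<omega>) ` I)) -` {..x} \<inter> space M"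
        by auto
    qed
    also have "\<dots> = cdf (distr M borel (\<lambda>\<omega>. Min ((\<lambda>i. \<xi> i \<omega>) ` I))) x"
      unfolding cdf_def using meas by (rule measure_distr[symmetric]) simp
    finally show "cdf F x \<le> cdf (distr M borel (\<lambda>\<omega>. Min ((\<lambda>i. \<xi> i \<omega>) ` I))) x" .
  qed

  have inf: "(\<integral>\<^sup>+ \<omega>. ennreal (g (Min ((\<lambda>i. \<xi> i \<omega>) ` I))) \<partial>M) = \<infinity>"
    if I: "I \<subseteq> {1..n}" "card I = k - 1" for I
  proof -
    have finI: "finite I" using I(1) finite_subset by blast
    have "I \<noteq> {}" using I(2) assms(6) by auto
    let ?E = "\<integral>\<^sup>+ \<omega>. ennreal (g (Min ((\<lambda>i. \<xi> i \<omega>) ` I))) \<partial>M"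
    have "of_nat N \<le> ?E" for N
    proof -
      obtain j where j: "N \<le> j" "S j = I" using S(2)[of I N] I by (auto simp: \<S>_def)
      define A where "A = {\<omega> \<in> space M. \<forall>i\<in>I. \<omega> i \<in> {a j<..}}"
      have "emeasure M A = (\<Prod>i\<in>I. emeasure F {a j<..})"
        unfolding A_def M_def by (rule P.emeasure_PiM_Collect) (use I finI in auto)
      then have emA: "emeasure M A = ennreal (F.prob {a j<..} ^ (k - 1))"
        using I(2) by (simp add: F.emeasure_eq_measure ennreal_power)
      \<comment> \<open>A set of positive measure is measurable, since \<open>emeasure\<close> vanishes off the sigma-algebra.\<close>
      have A_meas: "A \<in> sets M"
        using emA tail_pos[of "a j"] emeasure_notin_sets[of A M] by fastforce
      have "of_nat N \<le> ennreal (g (a (Suc j)) * F.prob {a j<..} ^ (k - 1))"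
        using a_sparse[of j] j(1) by (simp add: ennreal_of_nat_eq_real_of_nat ennreal_leI)
      also have "\<dots> = ennreal (g (a (Suc j))) * emeasure M A"
        using assms(3) by (simp add: emA ennreal_mult less_imp_le)
      also have "\<dots> = (\<integral>\<^sup>+ \<omega>. ennreal (g (a (Suc j))) * indicator A \<omega> \<partial>M)"
        using A_meas by (simp add: nn_integral_cmult_indicator)
      also have "\<dots> \<le> ?E"
      proof (rule nn_integral_mono)
        fix \<omega>
        show "ennreal (g (a (Suc j))) * indicator A \<omega> \<le> ennreal (g (Min ((\<lambda>i. \<xi> i \<omega>) ` I)))"
        proof (cases "\<omega> \<in> A")
          case True
          then have "a (Suc j) \<le> \<xi> i \<omega>" if "i \<in> I" for i
            using alternating_round_ge_next[OF a, of i S j "\<omega> i"] that j(2)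
            by (auto simp: A_def \<xi>_def)
          then have "a (Suc j) \<le> Min ((\<lambda>i. \<xi> i \<omega>) ` I)"
            using finI \<open>I \<noteq> {}\<close> by simp
          then show ?thesis
            using True assms(4) by (simp add: ennreal_leI strict_mono_less_eq)
        qed simp
      qed
      finally show ?thesis .
    qed
    then show ?thesis
      by (metis ennreal_Ex_less_of_nat infinity_ennreal_def not_le top.not_eq_extremum)
  qed

  show ?thesis
    using prob_M indep dom inf by blast
qed

end
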